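(* Let $F=\Phi T$ be a reciprocal transformation of a probability space $(X,\mathcal{B},\mu)$, where $T$ is a measure-preserving transformation and $\Phi$ is a scaling involution with scaling ratio $\rho>1$, and let $\widetilde{F}:X\times\mathbb{Z}\to X\times\mathbb{Z}$ be its discrete Maharam extension, with associated measure $\widetilde{\mu}$. Then $\widetilde{F}$ preserves the measure $\widetilde{\mu}$.
   Context: Conventions: $(X,\mathcal{B},\mu)$ is a non-atomic probability space. All definitions and set equalities are up to null sets. All maps are measurable bijections (after discarding a null set) for which images and preimages of measurable sets are measurable. A map $G$ preserves a measure $\nu$ if $\nu(G(E))=\nu(E)$ for all measurable $E$; a measure-preserving transformation $T$ of $X$ is a measurable bijection preserving $\mu$. Scaling involution: a measurable bijection $\Phi:X\to X$ with $\Phi^2=\mathrm{id}$ for which there is a set $S$ of positive measure such that $X=S\sqcup\Phi(S)$, $\mu(S)<\mu(\Phi(S))$, and $\mu(\Phi(E))=\rho\,\mu(E)$ for every measurable $E\subseteq S$, where $\rho=\mu(\Phi(S))/\mu(S)>1$ is the scaling ratio. A reciprocal transformation is a composition $F=\Phi T$ with $T$ measure-preserving and $\Phi$ a scaling involution. Discrete Maharam extension: let $\pi:X\times\mathbb{Z}\to X$ be the projection. On $X\times\mathbb{Z}$, with the product of $\mathcal{B}$ and the power set of $\mathbb{Z}$, put $$\widetilde{\mu}(E)=\sum_{n\in\mathbb{Z}}\rho^{-n}\mu\big(\pi(E_n)\big),\qquad E_n=E\cap(X\times\{n\}),$$ and define $\widetilde{F}(x,n)=(F(x),n+1)$ if $x\in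 T^{-1}(S)$ and $\widetilde{F}(x,n)=(F(x),n-1)$ if $x\in T^{-1}(\Phi(S))$. *)

theory Defs
  imports "HOL-Probability.Probability"
begin

definition nonatomic :: "'a measure \<Rightarrow> bool" where
  "nonatomic M \<longleftrightarrow>
     (\<forall>A\<in>sets M. 0 < emeasure M A \<longrightarrow>
        (\<exists>B\<in>sets M. B \<subseteq> A \<and> 0 < emeasure M B \<and> emeasure M B < emeasure M A))"

text \<open>
  Maps are only required to behave well after a null set has been discarded. In the definitions
  below, \<open>N\<close> is the discarded null set, and \<open>f ` (E - N)\<close> is the image of \<open>E\<close> under the map that
  remains; the values of \<open>f\<close> on \<open>N\<close> are irrelevant.
\<close>

definition bimeasurable_bij_off :: "'a measure \<Rightarrow> 'a set \<Rightarrow> ('a \<Rightarrow> 'a) \<Rightarrow> bool" where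
  "bimeasurable_bij_off M N f \<longleftrightarrow>
     N \<in> null_sets M \<and>
     bij_betw f (space M - N) (space M - N) \<and>
     (\<forall>E\<in>sets M. f ` (E - N) \<in> sets M) \<and>
     (\<forall>E\<in>sets M. f -` E \<inter> (space M - N) \<in> sets M)"

definition preserves_measure :: "'a measure \<Rightarrow> ('a \<Rightarrow> 'a) \<Rightarrow> bool" where
  "preserves_measure M f \<longleftrightarrow>
     (\<exists>N. bimeasurable_bij_off M N f \<and>
          (\<forall>E\<in>sets M. emeasure M (f ` (E - N)) = emeasure M E))"

text \<open>
  The decomposition of the space into \<open>S\<close> and its image is up to null sets. The ratio \<open>\<rho>\<close> is an
  argument of the predicate since the image of \<open>S\<close> depends on \<open>N\<close>; its value is
  determined by \<open>\<Phi>\<close> and \<open>S\<close>, and the conditions imply \<open>\<rho> > 1\<close>.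
\<close>

definition scaling_involution :: "'a measure \<Rightarrow> ('a \<Rightarrow> 'a) \<Rightarrow> 'a set \<Rightarrow> real \<Rightarrow> bool" where
  "scaling_involution M \<Phi> S \<rho> \<longleftrightarrow>
     (\<exists>N. bimeasurable_bij_off M N \<Phi> \<and>
          (\<forall>x\<in>space M - N. \<Phi> (\<Phi> x) = x) \<and>
          S \<in> sets M \<and> 0 < measure M S \<and>
          space M - (S \<union> \<Phi> ` (S - N)) \<in> null_sets M \<and>
          S \<inter> \<Phi> ` (S - N) \<in> null_sets M \<and>
          measure M S < measure M (\<Phi> ` (S - N)) \<and>
          \<rho> = measure M (\<Phi> ` (S - N)) / measure M S \<and>
          (\<forall>E\<in>sets M. E \<subseteq> S \<longrightarrow> measure M (\<Phi> ` (E - N)) = \<rho> * measure M E))"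

definition maharam_measure :: "'a measure \<Rightarrow> real \<Rightarrow> ('a \<times> int) measure" where
  "maharam_measure M \<rho> =
     measure_of (space M \<times> UNIV) (sets (M \<Otimes>\<^sub>M count_space (UNIV :: int set)))
       (\<lambda>E. \<Sum>\<^sub>\<infinity>n\<in>UNIV. ennreal (\<rho> powi (- n)) * emeasure M (fst ` (E \<inter> (space M \<times> {n}))))"

text \<open>
  The second case is meant for \<open>T x \<in> \<Phi> ` S\<close>. That set is the complement of \<open>S\<close> up to a null set, so
  testing \<open>T x \<in> S\<close> settles both cases for almost every \<open>x\<close>.
\<close>

definition maharam_extension ::
    "('a \<Rightarrow> 'a) \<Rightarrow> ('a \<Rightarrow> 'a) \<Rightarrow> 'a set \<Rightarrow> 'a \<times> int \<Rightarrow> 'a \<times> int" where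
  "maharam_extension F T S = (\<lambda>(x, n). (F x, if T x \<in> S then n + 1 else n - 1))"

lemma space_maharam_measure [simp]: "space (maharam_measure M \<rho>) = space M \<times> UNIV"
  and sets_maharam_measure [simp]:
    "sets (maharam_measure M \<rho>) = sets (M \<Otimes>\<^sub>M count_space UNIV)"
proof -
  have s: "space (M \<Otimes>\<^sub>M count_space (UNIV :: int set)) = space M \<times> UNIV"
    by (simp add: space_pair_measure)
  show "space (maharam_measure M \<rho>) = space M \<times> UNIV"
    unfolding maharam_measure_def s[symmetric] by (rule space_measure_of) (rule sets.space_closed)
  show "sets (maharam_measure M \<rho>) = sets (M \<Otimes>\<^sub>M count_space UNIV)"
    unfolding maharam_measure_def s[symmetric] by (simp add: sets.sigma_sets_eq)
qed

text \<open>The defining formula is countably additive, so it really gives the values of the measure.\<close>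

lemma emeasure_maharam_measure:
  assumes E: "E \<in> sets (M \<Otimes>\<^sub>M count_space (UNIV :: int set))"
  shows "emeasure (maharam_measure M \<rho>) E =
    (\<Sum>\<^sub>\<infinity>n\<in>UNIV. ennreal (\<rho> powi (- n)) * emeasure M (fst ` (E \<inter> (space M \<times> {n}))))"
proof -
  let ?A = "\<lambda>E n. fst ` (E \<inter> (space M \<times> {n :: int}))"
  let ?w = "\<lambda>n. ennreal (\<rho> powi (- n))"
  let ?P = "M \<Otimes>\<^sub>M count_space (UNIV :: int set)"
  define h :: "nat \<Rightarrow> int" where "h = from_nat_into UNIV"
  have h: "bij_betw h UNIV UNIV"
    unfolding h_def by (rule bij_betw_from_nat_into) (simp_all add: infinite_UNIV_int)
  have conv: "(\<Sum>\<^sub>\<infinity>n\<in>UNIV. f n) = (\<integral>\<^sup>+k. f (h k) \<partial>count_space UNIV)" for f :: "int \<Rightarrow> ennreal"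
  proof -
    have "((\<lambda>k. f (h k)) has_sum (\<Sum>\<^sub>\<infinity>k\<in>UNIV. f (h k))) UNIV"
      by (intro has_sum_infsum nonneg_summable_on_complete) simp
    then have "(\<lambda>k. f (h k)) sums (\<Sum>\<^sub>\<infinity>n\<in>UNIV. f n)"
      unfolding infsum_reindex_bij_betw[OF h] by (rule has_sum_imp_sums)
    then show ?thesis
      by (simp add: nn_integral_count_space_nat sums_iff)
  qed
  have slice: "?A X n = (\<lambda>x. (x, n)) -` X \<inter> space M" for X n
    by force
  have meas: "?A X n \<in> sets M" if "X \<in> sets ?P" for X n
    unfolding slice by (rule measurable_sets[OF _ that]) simp
  show ?thesis
  proof (rule emeasure_measure_of[OF maharam_measure_def])
    show "sets ?P \<subseteq> Pow (space M \<times> UNIV)"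
      using sets.space_closed[of ?P] by (simp add: space_pair_measure)
    show "E \<in> sets (maharam_measure M \<rho>)"
      using E by simp
    show "positive (sets (maharam_measure M \<rho>))
        (\<lambda>E. \<Sum>\<^sub>\<infinity>n\<in>UNIV. ?w n * emeasure M (?A E n))"
      by (simp add: positive_def)
    show "countably_additive (sets (maharam_measure M \<rho>))
        (\<lambda>E. \<Sum>\<^sub>\<infinity>n\<in>UNIV. ?w n * emeasure M (?A E n))"
    proof (rule countably_additiveI)
      fix B :: "nat \<Rightarrow> ('a \<times> int) set"
      assume B: "range B \<subseteq> sets (maharam_measure M \<rho>)" and dj: "disjoint_family B"
      have add: "(\<Sum>i. emeasure M (?A (B i) n)) = emeasure M (?A (\<Union>i. B i) n)" for n
      proof -
        have "(\<Sum>i. emeasure M (?A (B i) n)) = emeasure M (\<Union>i. ?A (B i) n)"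
        proof (rule suminf_emeasure)
          show "range (\<lambda>i. ?A (B i) n) \<subseteq> sets M"
            using B by (auto intro!: meas)
          show "disjoint_family (\<lambda>i. ?A (B i) n)"
            unfolding slice using dj by (fastforce simp: disjoint_family_on_def)
        qed
        also have "(\<Union>i. ?A (B i) n) = ?A (\<Union>i. B i) n"
          by auto
        finally show ?thesis .
      qed
      show "(\<Sum>i. \<Sum>\<^sub>\<infinity>n\<in>UNIV. ?w n * emeasure M (?A (B i) n)) =
          (\<Sum>\<^sub>\<infinity>n\<in>UNIV. ?w n * emeasure M (?A (\<Union>i. B i) n))"
        unfolding conv by (simp add: nn_integral_suminf[symmetric] add)
    qed
  qed
qed

end

theory Submission
  imports Defs
begin

text \<open>
  If a map \<open>F\<close> multiplies measures by \<open>\<rho> powi k\<close> on the set where an integer valued function \<open>c\<close>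
  is \<open>k\<close>, then \<open>(x, n) \<mapsto> (F x, n + c x)\<close> preserves the Maharam measure: the factor
  \<open>\<rho> powi k\<close> gained in the first coordinate is cancelled by the factor \<open>\<rho> powi (- k)\<close> between the
  weights of two levels at distance \<open>k\<close>. To see this, cut a set into the countably many pieces
  \<open>A \<times> {n}\<close> on which \<open>c\<close> has a constant value \<open>k\<close>. Each piece is sent to
  \<open>F ` A \<times> {n + k}\<close>, which has the same measure, and these images are disjoint because the extension
  is injective (\<open>cocycle_extension_preserves_maharam_measure\<close>).

  For a reciprocal transformation \<open>F = \<Phi> T\<close>, the function \<open>c\<close> is \<open>1\<close> where \<open>T x \<in> S\<close> and \<open>- 1\<close>
  elsewhere. On the first set \<open>F\<close> multiplies measures by \<open>\<rho>\<close>, since \<open>T\<close> preserves the measure and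
  \<open>\<Phi>\<close> scales subsets of \<open>S\<close> by \<open>\<rho>\<close>. Almost everywhere on the second set \<open>T x \<in> \<Phi> ` S\<close>, and since
  \<open>\<Phi>\<close> is an involution, it scales subsets of \<open>\<Phi> ` S\<close> by \<open>1 / \<rho>\<close>.

  What remains is the handling of null sets. The maps \<open>T\<close> and \<open>\<Phi>\<close> are bijections off different null
  sets, and their composition is again one off any null set that contains both and is invariant under
  both maps. Such a set exists because \<open>T\<close> and \<open>\<Phi>\<close> are nonsingular, so that the saturation of a null set under
  countably many images and preimages is null (\<open>common_invariant_null_set\<close>).
\<close>

section \<open>Nonsingular maps and invariant null sets\<close>

definition nonsingular_off :: "'a measure \<Rightarrow> 'a set \<Rightarrow> ('a \<Rightarrow> 'a) \<Rightarrow> bool" where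
  "nonsingular_off M N f \<longleftrightarrow>
     bimeasurable_bij_off M N f \<and>
     (\<forall>B\<in>null_sets M. f ` (B - N) \<in> null_sets M \<and> f -` B \<inter> (space M - N) \<in> null_sets M)"

lemma bimeasurable_bij_offD:
  assumes "bimeasurable_bij_off M N f"
  shows "N \<in> null_sets M" "bij_betw f (space M - N) (space M - N)"
    "E \<in> sets M \<Longrightarrow> f ` (E - N) \<in> sets M"
    "E \<in> sets M \<Longrightarrow> f -` E \<inter> (space M - N) \<in> sets M"
  using assms by (auto simp: bimeasurable_bij_off_def)

lemma measure_preserving_nonsingular:
  assumes bij: "bimeasurable_bij_off M N f"
    and pres: "\<And>E. E \<in> sets M \<Longrightarrow> emeasure M (f ` (E - N)) = emeasure M E"
  shows "nonsingular_off M N f"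
  unfolding nonsingular_off_def
proof (intro conjI ballI)
  fix B assume B: "B \<in> null_sets M"
  note b = bimeasurable_bij_offD[OF bij]
  show "f ` (B - N) \<in> null_sets M"
    using B b(3) pres[of B] by (auto simp: null_sets_def)
  let ?P = "f -` B \<inter> (space M - N)"
  have P: "?P \<in> sets M" using b(4) B by auto
  have "f ` (?P - N) \<subseteq> B" by auto
  then have "emeasure M (f ` (?P - N)) = 0"
    using B emeasure_mono[of "f ` (?P - N)" B M] by (auto simp: null_sets_def)
  then show "?P \<in> null_sets M"
    using P pres[OF P] by (simp add: null_sets_def)
qed (rule bij)

text \<open>
  Invariance under both images and preimages makes \<open>f\<close> a bijection of the complement of \<open>N'\<close>. The
  values of \<open>f\<close> on \<open>N\<close> are arbitrary, so invariance can only refer to points off \<open>N\<close>.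
\<close>

lemma bimeasurable_bij_off_enlarge:
  assumes bij: "bimeasurable_bij_off M N f" and sub: "N \<subseteq> N'" and null: "N' \<in> null_sets M"
    and img: "f ` (N' - N) \<subseteq> N'" and pre: "f -` N' \<inter> (space M - N) \<subseteq> N'"
  shows "bimeasurable_bij_off M N' f"
  unfolding bimeasurable_bij_off_def
proof (intro conjI ballI)
  note b = bimeasurable_bij_offD[OF bij]
  have inj: "inj_on f (space M - N)" and surj: "f ` (space M - N) = space M - N"
    using b(2) by (auto simp: bij_betw_def)
  have "f ` (space M - N') = space M - N'"
  proof
    show "f ` (space M - N') \<subseteq> space M - N'"
      using sub surj pre by blast
    show "space M - N' \<subseteq> f ` (space M - N')"
    proof
      fix y assume y: "y \<in> space M - N'"
      then obtain x where x: "x \<in> space M - N" "y = f x"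
        using sub surj by blast
      then have "x \<notin> N'" using img y by blast
      then show "y \<in> f ` (space M - N')" using x by blast
    qed
  qed
  then show "bij_betw f (space M - N') (space M - N')"
    using inj sub by (auto simp: bij_betw_def intro: inj_on_subset)
  fix E assume E: "E \<in> sets M"
  have "f ` (E - N') = f ` ((E - N') - N)"
    using sub by (intro arg_cong[where f = "(`) f"]) blast
  also have "\<dots> \<in> sets M"
    using E null by (intro b(3)) auto
  finally show "f ` (E - N') \<in> sets M" .
  have "f -` E \<inter> (space M - N') = (f -` E \<inter> (space M - N)) - N'"
    using sub by blast
  also have "\<dots> \<in> sets M"
    using b(4)[OF E] null by auto
  finally show "f -` E \<inter> (space M - N') \<in> sets M" .
qed (rule null)

lemma bimeasurable_bij_off_comp:
  assumes f: "bimeasurable_bij_off M N f" and g: "bimeasurable_bij_off M N g"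
  shows "bimeasurable_bij_off M N (g \<circ> f)"
  unfolding bimeasurable_bij_off_def
proof (intro conjI ballI)
  note f = bimeasurable_bij_offD[OF f] and g = bimeasurable_bij_offD[OF g]
  show "N \<in> null_sets M" by (rule f)
  show "bij_betw (g \<circ> f) (space M - N) (space M - N)"
    using f(2) g(2) by (rule bij_betw_trans)
  have f_maps: "f x \<in> space M - N" if "x \<in> space M - N" for x
    using f(2) that by (auto simp: bij_betw_def)
  fix E assume E: "E \<in> sets M"
  have "f ` (E - N) \<inter> N = {}"
    using f_maps sets.sets_into_space[OF E] by blast
  then have "(g \<circ> f) ` (E - N) = g ` (f ` (E - N) - N)"
    by (simp add: image_comp Diff_triv)
  then show "(g \<circ> f) ` (E - N) \<in> sets M"
    using g(3)[OF f(3)[OF E]] by simp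
  have "(g \<circ> f) -` E \<inter> (space M - N) = f -` (g -` E \<inter> (space M - N)) \<inter> (space M - N)"
    using f_maps by auto
  then show "(g \<circ> f) -` E \<inter> (space M - N) \<in> sets M"
    using f(4)[OF g(4)[OF E]] by simp
qed

lemma bimeasurable_bij_off_cong:
  assumes f: "bimeasurable_bij_off M N f" and eq: "\<And>x. x \<in> space M - N \<Longrightarrow> g x = f x"
  shows "bimeasurable_bij_off M N g"
proof -
  have "g ` (E - N) = f ` (E - N)" if "E \<in> sets M" for E
    using sets.sets_into_space[OF that] eq by (intro image_cong) auto
  moreover have "g -` E \<inter> (space M - N) = f -` E \<inter> (space M - N)" for E
    using eq by auto
  moreover have "bij_betw g (space M - N) (space M - N)"
    using bimeasurable_bij_offD(2)[OF f] bij_betw_cong[of "space M - N" g f] eq by blast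
  ultimately show ?thesis
    using f by (simp add: bimeasurable_bij_off_def)
qed

text \<open>
  Nonsingularity keeps each step of the saturation under images and preimages null, and the
  saturation is reached after countably many steps.
\<close>

lemma common_invariant_null_set:
  assumes f: "nonsingular_off M Nf f" and g: "nonsingular_off M Ng g"
    and B: "B \<in> null_sets M"
  obtains N where "B \<subseteq> N" "bimeasurable_bij_off M N f" "bimeasurable_bij_off M N g"
proof -
  define H where "H A = A \<union> (f ` (A - Nf) \<union> (f -` A \<inter> (space M - Nf)))
    \<union> (g ` (A - Ng) \<union> (g -` A \<inter> (space M - Ng)))" for A
  define C where "C k = (H ^^ k) (B \<union> Nf \<union> Ng)" for k :: nat
  define N where "N = (\<Union>k. C k)"
  have bf: "bimeasurable_bij_off M Nf f" and bg: "bimeasurable_bij_off M Ng g"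
    using f g by (auto simp: nonsingular_off_def)
  have H_null: "H A \<in> null_sets M" if "A \<in> null_sets M" for A
    using f g that unfolding H_def nonsingular_off_def by (intro null_sets.Un) auto
  have C_Suc: "C (Suc k) = H (C k)" for k
    by (simp add: C_def)
  have "C k \<in> null_sets M" for k
  proof (induction k)
    case 0
    show ?case
      using B bimeasurable_bij_offD(1)[OF bf] bimeasurable_bij_offD(1)[OF bg]
      by (auto simp: C_def)
  qed (simp add: C_Suc H_null)
  then have N: "N \<in> null_sets M"
    unfolding N_def by (rule null_sets_UN)
  have "C 0 \<subseteq> N" by (auto simp: N_def)
  then have sub: "B \<subseteq> N" "Nf \<subseteq> N" "Ng \<subseteq> N" by (auto simp: C_def)
  have "H (C k) \<subseteq> N" for k
    unfolding C_Suc[symmetric] N_def by auto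
  then have step:
    "f ` (C k - Nf) \<subseteq> N" "f -` C k \<inter> (space M - Nf) \<subseteq> N"
    "g ` (C k - Ng) \<subseteq> N" "g -` C k \<inter> (space M - Ng) \<subseteq> N" for k
    unfolding H_def by auto
  have unions:
    "f ` (N - Nf) = (\<Union>k. f ` (C k - Nf))"
    "f -` N \<inter> (space M - Nf) = (\<Union>k. f -` C k \<inter> (space M - Nf))"
    "g ` (N - Ng) = (\<Union>k. g ` (C k - Ng))"
    "g -` N \<inter> (space M - Ng) = (\<Union>k. g -` C k \<inter> (space M - Ng))"
    unfolding N_def by blast+
  have inv:
    "f ` (N - Nf) \<subseteq> N" "f -` N \<inter> (space M - Nf) \<subseteq> N"
    "g ` (N - Ng) \<subseteq> N" "g -` N \<inter> (space M - Ng) \<subseteq> N"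
    unfolding unions by (intro UN_least step)+
  show thesis
    using sub(1) bimeasurable_bij_off_enlarge[OF bf sub(2) N inv(1,2)]
      bimeasurable_bij_off_enlarge[OF bg sub(3) N inv(3,4)] by (rule that)
qed

section \<open>Extensions by integer cocycles\<close>

lemma emeasure_maharam_measure_Times_singleton:
  assumes A: "A \<in> sets M"
  shows "emeasure (maharam_measure M \<rho>) (A \<times> {n}) = ennreal (\<rho> powi (- n)) * emeasure M A"
proof -
  have "A \<times> {n} \<in> sets (M \<Otimes>\<^sub>M count_space UNIV)"
    using A by (intro pair_measureI) auto
  moreover have "fst ` (A \<times> {n} \<inter> (space M \<times> {m})) = (if m = n then A else {})" for m
    using sets.sets_into_space[OF A] by force
  ultimately have "emeasure (maharam_measure M \<rho>) (A \<times> {n}) =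
      (\<Sum>\<^sub>\<infinity>m\<in>UNIV. ennreal (\<rho> powi (- m)) * emeasure M (if m = n then A else {}))"
    by (simp add: emeasure_maharam_measure)
  also have "\<dots> = (\<Sum>\<^sub>\<infinity>m\<in>{n}. ennreal (\<rho> powi (- m)) * emeasure M (if m = n then A else {}))"
    by (rule infsum_cong_neutral) auto
  finally show ?thesis by simp
qed

text \<open>
  On a piece \<open>A \<times> {n}\<close> where \<open>c = k\<close>, the scaling factor \<open>\<rho> powi k\<close> is exactly the ratio of the
  weights of the levels \<open>n\<close> and \<open>n + k\<close>, and every set splits into countably many such pieces.
\<close>

lemma cocycle_extension_preserves_maharam_measure:
  fixes c :: "'a \<Rightarrow> int" and \<rho> :: real
  assumes bij: "bimeasurable_bij_off M N F"
    and c: "\<And>k. {x \<in> space M - N. c x = k} \<in> sets M"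
    and pos: "\<rho> > 0"
    and scale: "\<And>E k. E \<in> sets M \<Longrightarrow> E \<subseteq> {x \<in> space M - N. c x = k} \<Longrightarrow>
      emeasure M (F ` E) = ennreal (\<rho> powi k) * emeasure M E"
  shows "preserves_measure (maharam_measure M \<rho>) (\<lambda>(x, n). (F x, n + c x))"
proof -
  note b = bimeasurable_bij_offD[OF bij]
  let ?G = "\<lambda>(x, n). (F x, n + c x)"
  let ?P = "maharam_measure M \<rho>"
  let ?N = "N \<times> (UNIV :: int set)"
  define L where "L k = {x \<in> space M - N. c x = k}" for k
  have inj: "inj_on F (space M - N)" and surj: "F ` (space M - N) = space M - N"
    using b(2) by (auto simp: bij_betw_def)
  have N: "N \<in> sets M" using b(1) by auto
  have L: "L k \<in> sets M" for k
    using c by (simp add: L_def)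
  have rect: "A \<times> {n} \<in> sets ?P" if "A \<in> sets M" for A n
    using that by (simp add: pair_measureI)
  have slice: "(\<lambda>x. (x, n)) -` E \<in> sets M" if "E \<in> sets ?P" for E n
    using that by (simp add: sets_Pair2)
  have off: "space ?P - ?N = (space M - N) \<times> UNIV" by auto
  have "?N = (\<Union>n. N \<times> {n})" by auto
  moreover have "(\<Union>n :: int. N \<times> {n}) \<in> null_sets ?P"
    using b(1) N rect
    by (intro null_sets_UN) (auto simp: null_sets_def emeasure_maharam_measure_Times_singleton)
  ultimately have null: "?N \<in> null_sets ?P" by simp
  have injG: "inj_on ?G ((space M - N) \<times> UNIV)"
  proof (rule inj_onI)
    fix p q assume pq: "p \<in> (space M - N) \<times> UNIV" "q \<in> (space M - N) \<times> UNIV" "?G p = ?G q"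
    have "F (fst p) = F (fst q)" and eq: "snd p + c (fst p) = snd q + c (fst q)"
      using pq(3) by (simp_all add: case_prod_beta)
    moreover have "fst p \<in> space M - N" "fst q \<in> space M - N"
      using pq(1,2) by (simp_all add: mem_Times_iff)
    ultimately have "fst p = fst q" by (blast intro: inj_onD[OF inj])
    with eq show "p = q" by (simp add: prod_eq_iff)
  qed
  have surjG: "?G ` ((space M - N) \<times> UNIV) = (space M - N) \<times> UNIV"
  proof
    show "?G ` ((space M - N) \<times> UNIV) \<subseteq> (space M - N) \<times> UNIV"
      using surj by auto
    show "(space M - N) \<times> UNIV \<subseteq> ?G ` ((space M - N) \<times> UNIV)"
    proof clarify
      fix y m assume "y \<in> space M" "y \<notin> N"
      then obtain x where x: "x \<in> space M - N" "y = F x" using surj by blast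
      then show "(y, m) \<in> ?G ` ((space M - N) \<times> UNIV)"
        by (intro image_eqI[of _ _ "(x, m - c x)"]) auto
    qed
  qed
  \<comment> \<open>\<open>A E n k\<close> is the base of the piece of \<open>E\<close> on level \<open>n\<close> that moves up by \<open>k\<close> levels.\<close>
  define A where "A E n k = (\<lambda>x. (x, n)) -` E \<inter> L k" for E :: "('a \<times> int) set" and n k
  have A: "A E n k \<in> sets M" if "E \<in> sets ?P" for E n k
    using slice[OF that] L by (auto simp: A_def)
  have A_sub: "A E n k \<subseteq> L k" "A E n k - N = A E n k" for E n k
    by (auto simp: A_def L_def)
  have FA: "F ` A E n k \<in> sets M" if "E \<in> sets ?P" for E n k
    using b(3)[OF A[OF that, of n k]] A_sub by simp
  have E_sub: "E \<subseteq> space M \<times> UNIV" if "E \<in> sets ?P" for E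
    using sets.sets_into_space[OF that] by simp
  have pieces: "E - ?N = (\<Union>(n, k). A E n k \<times> {n})" if "E \<in> sets ?P" for E
    using E_sub[OF that] by (auto simp: A_def L_def)
  have image_piece: "?G ` (A E n k \<times> {n}) = F ` A E n k \<times> {n + k}" for E n k
    by (force simp: A_def L_def)
  have image_pieces: "?G ` (E - ?N) = (\<Union>(n, k). F ` A E n k \<times> {n + k})"
    if "E \<in> sets ?P" for E
    unfolding pieces[OF that] image_UN
    by (intro SUP_cong refl) (clarsimp simp only: image_piece split: prod.splits)
  have "bimeasurable_bij_off ?P ?N ?G"
    unfolding bimeasurable_bij_off_def off
  proof (intro conjI ballI)
    show "bij_betw ?G ((space M - N) \<times> UNIV) ((space M - N) \<times> UNIV)"
      using injG surjG by (simp add: bij_betw_def)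
    fix E assume E: "E \<in> sets ?P"
    show "?G ` (E - ?N) \<in> sets ?P"
      unfolding image_pieces[OF E]
      by (intro sets.countable_UN'') (auto intro!: rect FA[OF E] simp del: sets_maharam_measure)
    have "?G -` E \<inter> ((space M - N) \<times> UNIV) =
        (\<Union>(n, k). ((F -` ((\<lambda>x. (x, n + k)) -` E) \<inter> (space M - N)) \<inter> L k) \<times> {n})"
      by (auto simp: L_def)
    also have "\<dots> \<in> sets ?P"
      by (intro sets.countable_UN'')
        (auto intro!: rect sets.Int b(4) slice[OF E] L simp del: sets_maharam_measure)
    finally show "?G -` E \<inter> ((space M - N) \<times> UNIV) \<in> sets ?P" .
  qed (rule null)
  moreover have "emeasure ?P (?G ` (E - ?N)) = emeasure ?P E" if E: "E \<in> sets ?P" for E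
  proof -
    let ?I = "\<lambda>p. case p of (n, k) \<Rightarrow> A E n k \<times> {n}"
    let ?J = "\<lambda>p. case p of (n, k) \<Rightarrow> F ` A E n k \<times> {n + k}"
    have J: "?J p = ?G ` ?I p" for p
      by (cases p) (simp only: image_piece prod.case)
    have I_sub: "?I p \<subseteq> (space M - N) \<times> UNIV" for p
      by (auto simp: A_def L_def)
    \<comment> \<open>Injectivity of the extension carries disjointness of the pieces over to their images.\<close>
    have disj: "disjoint_family ?I"
      by (auto simp: disjoint_family_on_def A_def L_def)
    have "disjoint_family ?J"
      unfolding disjoint_family_on_def
    proof (intro ballI impI)
      fix p q :: "int \<times> int" assume "p \<noteq> q"
      then have "?I p \<inter> ?I q = {}"
        using disj unfolding disjoint_family_on_def by blast
      then show "?J p \<inter> ?J q = {}"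
        unfolding J inj_on_image_Int[OF injG I_sub I_sub, symmetric] by simp
    qed
    then have "emeasure ?P (\<Union>p. ?J p) = (\<integral>\<^sup>+p. emeasure ?P (?J p) \<partial>count_space UNIV)"
      by (intro emeasure_UN_countable) (auto intro!: rect FA[OF E] simp del: sets_maharam_measure)
    also have "\<dots> = (\<integral>\<^sup>+p. emeasure ?P (?I p) \<partial>count_space UNIV)"
    proof (intro nn_integral_cong)
      fix p :: "int \<times> int"
      obtain n k where p: "p = (n, k)" by fastforce
      have "emeasure ?P (F ` A E n k \<times> {n + k}) =
          ennreal (\<rho> powi (- (n + k))) * (ennreal (\<rho> powi k) * emeasure M (A E n k))"
        using scale[OF A[OF E] A_sub(1)[unfolded L_def]] FA[OF E]
        by (simp add: emeasure_maharam_measure_Times_singleton)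
      also have "\<dots> = ennreal (\<rho> powi (- (n + k)) * \<rho> powi k) * emeasure M (A E n k)"
        using pos by (simp add: ennreal_mult' mult.assoc)
      also have "\<rho> powi (- (n + k)) * \<rho> powi k = \<rho> powi (- n)"
        using pos by (simp flip: power_int_add)
      finally show "emeasure ?P (?J p) = emeasure ?P (?I p)"
        using A[OF E] by (simp add: p emeasure_maharam_measure_Times_singleton)
    qed
    also have "\<dots> = emeasure ?P (\<Union>p. ?I p)"
      using disj
      by (intro emeasure_UN_countable[symmetric])
        (auto intro!: rect A[OF E] simp del: sets_maharam_measure)
    also have "\<dots> = emeasure ?P E"
      unfolding pieces[OF E, symmetric] by (rule emeasure_Diff_null_set[OF null E])
    finally show ?thesis
      unfolding image_pieces[OF E] .
  qed
  ultimately show ?thesis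
    unfolding preserves_measure_def by blast
qed

section \<open>Scaling involutions\<close>

lemma involution_off_image_eq_vimage:
  assumes bij: "bimeasurable_bij_off M N \<Phi>" and invol: "\<And>x. x \<in> space M - N \<Longrightarrow> \<Phi> (\<Phi> x) = x"
    and E: "E \<subseteq> space M"
  shows "\<Phi> ` (E - N) = \<Phi> -` E \<inter> (space M - N)"
proof -
  have maps: "\<Phi> x \<in> space M - N" if "x \<in> space M - N" for x
    using bimeasurable_bij_offD(2)[OF bij] that by (auto simp: bij_betw_def)
  show ?thesis
  proof (intro equalityI subsetI)
    fix y assume "y \<in> \<Phi> ` (E - N)"
    then show "y \<in> \<Phi> -` E \<inter> (space M - N)"
      using maps invol E by auto
  next
    fix y assume y: "y \<in> \<Phi> -` E \<inter> (space M - N)"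
    then show "y \<in> \<Phi> ` (E - N)"
      using maps[of y] invol[of y] by (intro image_eqI[of _ _ "\<Phi> y"]) auto
  qed
qed

text \<open>
  The scaling of subsets of \<open>\<Phi> ` S\<close> is that of their images, which lie in \<open>S\<close>, read backwards.
\<close>

lemma involution_scales_back:
  assumes bij: "bimeasurable_bij_off M N \<Phi>" and invol: "\<And>x. x \<in> space M - N \<Longrightarrow> \<Phi> (\<Phi> x) = x"
    and scale: "\<And>E. E \<in> sets M \<Longrightarrow> E \<subseteq> S \<Longrightarrow> measure M (\<Phi> ` (E - N)) = \<rho> * measure M E"
    and S: "S \<subseteq> space M" and E: "E \<in> sets M" "E \<subseteq> \<Phi> ` (S - N)"
  shows "measure M E = \<rho> * measure M (\<Phi> ` (E - N))"
proof -
  have E_off: "E \<subseteq> space M - N"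
    using E(2) involution_off_image_eq_vimage[OF bij invol S] by blast
  have "\<Phi> ` (E - N) \<subseteq> S"
    using E(2) involution_off_image_eq_vimage[OF bij invol S] by blast
  moreover have "\<Phi> ` (\<Phi> ` (E - N) - N) = E"
  proof -
    have "\<Phi> ` (E - N) \<inter> N = {}"
      using E_off bimeasurable_bij_offD(2)[OF bij] by (auto simp: bij_betw_def)
    then have "\<Phi> ` (\<Phi> ` (E - N) - N) = \<Phi> ` \<Phi> ` (E - N)"
      by (simp add: Diff_triv)
    also have "\<dots> = (\<lambda>x. x) ` (E - N)"
      unfolding image_image using E_off invol by (intro image_cong) auto
    finally show ?thesis using E_off by auto
  qed
  ultimately show ?thesis
    using scale[of "\<Phi> ` (E - N)"] bimeasurable_bij_offD(3)[OF bij E(1)] by simp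
qed

text \<open>
  Scaling controls the images of null subsets of \<open>S\<close> and of \<open>\<Phi> ` S\<close>. The null set outside
  \<open>S \<union> \<Phi> ` S\<close> is mapped into itself, as \<open>\<Phi>\<close> exchanges \<open>S\<close> and \<open>\<Phi> ` S\<close>. For an
  involution, preimages of null sets are images.
\<close>

lemma scaling_involution_nonsingular:
  assumes "finite_measure M"
    and bij: "bimeasurable_bij_off M N \<Phi>" and invol: "\<And>x. x \<in> space M - N \<Longrightarrow> \<Phi> (\<Phi> x) = x"
    and S: "S \<in> sets M" and cover: "space M - (S \<union> \<Phi> ` (S - N)) \<in> null_sets M"
    and pos: "\<rho> > 0"
    and scale: "\<And>E. E \<in> sets M \<Longrightarrow> E \<subseteq> S \<Longrightarrow> measure M (\<Phi> ` (E - N)) = \<rho> * measure M E"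
  shows "nonsingular_off M N \<Phi>"
proof -
  interpret finite_measure M by fact
  note b = bimeasurable_bij_offD[OF bij]
  let ?A = "\<Phi> ` (S - N)"
  let ?Z = "space M - (S \<union> ?A)"
  have S_space: "S \<subseteq> space M" by (rule sets.sets_into_space[OF S])
  have A_eq: "?A = \<Phi> -` S \<inter> (space M - N)"
    using bij invol S_space by (rule involution_off_image_eq_vimage)
  have A: "?A \<in> sets M" by (rule b(3)[OF S])
  have null_iff: "E \<in> null_sets M \<longleftrightarrow> E \<in> sets M \<and> measure M E = 0" for E
    by (auto simp: null_sets_def emeasure_eq_measure)
  have img: "\<Phi> ` (B - N) \<in> null_sets M" if B: "B \<in> null_sets M" for B
  proof -
    have "measure M (\<Phi> ` (B \<inter> S - N)) = \<rho> * measure M (B \<inter> S)"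
      using B S by (intro scale) auto
    moreover have "measure M (B \<inter> S) = 0"
      using null_set_Int2[OF B S] by (simp add: null_iff)
    ultimately have 1: "\<Phi> ` (B \<inter> S - N) \<in> null_sets M"
      using b(3)[of "B \<inter> S"] B S by (auto simp: null_iff)
    have "measure M (B \<inter> ?A) = \<rho> * measure M (\<Phi> ` (B \<inter> ?A - N))"
      using B A by (intro involution_scales_back[OF bij invol scale S_space]) auto
    moreover have "measure M (B \<inter> ?A) = 0"
      using null_set_Int2[OF B A] B A by (simp add: null_iff)
    ultimately have 2: "\<Phi> ` (B \<inter> ?A - N) \<in> null_sets M"
      using b(3)[of "B \<inter> ?A"] B A pos by (auto simp: null_iff)
    have "\<Phi> ` (?Z - N) \<subseteq> ?Z"
    proof (intro image_subsetI)
      fix z assume z: "z \<in> ?Z - N"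
      then have maps: "\<Phi> z \<in> space M - N" using b(2) by (auto simp: bij_betw_def)
      have "\<Phi> z \<notin> S" using z by (auto simp: A_eq)
      moreover have "\<Phi> z \<notin> ?A" using z invol[of z] by (auto simp: A_eq)
      ultimately show "\<Phi> z \<in> ?Z" using maps by simp
    qed
    then have 3: "\<Phi> ` (?Z - N) \<in> null_sets M"
      using cover b(3)[of ?Z] by (intro null_sets_subset[OF cover]) auto
    have "\<Phi> ` (B - N) \<subseteq> \<Phi> ` (B \<inter> S - N) \<union> \<Phi> ` (B \<inter> ?A - N) \<union> \<Phi> ` (?Z - N)"
    proof -
      have "B \<subseteq> space M" using B sets.sets_into_space by blast
      then have "B - N \<subseteq> (B \<inter> S - N) \<union> (B \<inter> ?A - N) \<union> (?Z - N)" by blast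
      then show ?thesis unfolding image_Un[symmetric] by (rule image_mono)
    qed
    then show ?thesis
      using b(3)[of B] B by (intro null_sets_subset[OF null_sets.Un[OF null_sets.Un[OF 1 2] 3]]) auto
  qed
  moreover have "\<Phi> -` B \<inter> (space M - N) = \<Phi> ` (B - N)" if "B \<in> null_sets M" for B
  proof -
    have "B \<subseteq> space M" using that sets.sets_into_space by blast
    with bij invol show ?thesis by (rule involution_off_image_eq_vimage[symmetric])
  qed
  ultimately show ?thesis
    unfolding nonsingular_off_def using bij by simp
qed

section \<open>Reciprocal transformations\<close>

theorem proposition9:
  fixes M :: "'a measure" and F T \<Phi> :: "'a \<Rightarrow> 'a" and S :: "'a set" and \<rho> :: real
  assumes "prob_space M"
    and "nonatomic M"
    and "preserves_measure M T"
    and "scaling_involution M \<Phi> S \<rho>"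
    and "AE x in M. F x = \<Phi> (T x)"
  shows "preserves_measure (maharam_measure M \<rho>) (maharam_extension F T S)"
proof -
  interpret prob_space M by fact
  obtain NT where T: "bimeasurable_bij_off M NT T"
    and T_pres: "\<And>E. E \<in> sets M \<Longrightarrow> emeasure M (T ` (E - NT)) = emeasure M E"
    using assms(3) unfolding preserves_measure_def by blast
  obtain NP where P: "bimeasurable_bij_off M NP \<Phi>"
    and invol: "\<And>x. x \<in> space M - NP \<Longrightarrow> \<Phi> (\<Phi> x) = x"
    and S: "S \<in> sets M" and S_pos: "0 < measure M S"
    and cover: "space M - (S \<union> \<Phi> ` (S - NP)) \<in> null_sets M"
    and less: "measure M S < measure M (\<Phi> ` (S - NP))"
    and rho: "\<rho> = measure M (\<Phi> ` (S - NP)) / measure M S"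
    and scale: "\<And>E. E \<in> sets M \<Longrightarrow> E \<subseteq> S \<Longrightarrow> measure M (\<Phi> ` (E - NP)) = \<rho> * measure M E"
    using assms(4) unfolding scaling_involution_def by blast
  have pos: "\<rho> > 0" using S_pos less rho by simp
  obtain NF where NF: "NF \<in> null_sets M" "{x \<in> space M. F x \<noteq> \<Phi> (T x)} \<subseteq> NF"
    using AE_E[OF assms(5)] by (metis null_setsI)
  let ?Z = "space M - (S \<union> \<Phi> ` (S - NP))"
  have "NT \<union> NP \<union> NF \<union> ?Z \<in> null_sets M"
    using bimeasurable_bij_offD(1)[OF T] bimeasurable_bij_offD(1)[OF P] NF(1) cover
    by (intro null_sets.Un)
  then obtain N where N: "NT \<union> NP \<union> NF \<union> ?Z \<subseteq> N"
    and TN: "bimeasurable_bij_off M N T" and PN: "bimeasurable_bij_off M N \<Phi>"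
    using common_invariant_null_set[OF measure_preserving_nonsingular[OF T T_pres]
        scaling_involution_nonsingular[OF finite_measure_axioms P invol S cover pos scale]]
    by blast
  \<comment> \<open>Off \<open>N\<close>, which is invariant under both maps, all the almost everywhere hypotheses hold at every
    point, along whole orbits.\<close>
  have F_eq: "F x = \<Phi> (T x)" if "x \<in> space M - N" for x
    using that N NF(2) by blast
  have FN: "bimeasurable_bij_off M N F"
    by (rule bimeasurable_bij_off_cong[OF bimeasurable_bij_off_comp[OF TN PN]]) (simp add: F_eq)
  define c where "c x = (if T x \<in> S then 1 else - 1 :: int)" for x
  have "preserves_measure (maharam_measure M \<rho>) (\<lambda>(x, n). (F x, n + c x))"
  proof (rule cocycle_extension_preserves_maharam_measure[OF FN _ pos])
    fix k :: int
    have TS: "T -` S \<inter> (space M - N) \<in> sets M"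
      by (rule bimeasurable_bij_offD(4)[OF TN S])
    have N_sets: "N \<in> sets M" using bimeasurable_bij_offD(1)[OF TN] by auto
    consider "k = 1" | "k = - 1" | "k \<noteq> 1" "k \<noteq> - 1" by blast
    then show "{x \<in> space M - N. c x = k} \<in> sets M"
    proof cases
      case 1
      then have "{x \<in> space M - N. c x = k} = T -` S \<inter> (space M - N)"
        by (auto simp: c_def)
      then show ?thesis using TS by simp
    next
      case 2
      then have "{x \<in> space M - N. c x = k} = (space M - N) - (T -` S \<inter> (space M - N))"
        by (auto simp: c_def split: if_splits)
      then show ?thesis using TS N_sets by simp
    next
      case 3
      then have "{x \<in> space M - N. c x = k} = {}" by (auto simp: c_def)
      then show ?thesis by (simp only: sets.empty_sets)
    qed
  next
    fix E and k :: int assume E: "E \<in> sets M" "E \<subseteq> {x \<in> space M - N. c x = k}"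
    let ?D = "T ` E"
    have "E - NT = E" "E - N = E" using E(2) N by auto
    then have D: "?D \<in> sets M" "emeasure M ?D = emeasure M E"
      using bimeasurable_bij_offD(3)[OF T E(1)] T_pres[OF E(1)] by simp_all
    have D_off: "?D \<subseteq> space M - N"
      using E(2) bimeasurable_bij_offD(2)[OF TN] by (auto simp: bij_betw_def)
    have "F ` E = \<Phi> ` ?D"
      unfolding image_image using E(2) F_eq by (intro image_cong) auto
    moreover have "?D - NP = ?D" using D_off N by auto
    ultimately have FE: "F ` E = \<Phi> ` (?D - NP)" by simp
    have "measure M (\<Phi> ` (?D - NP)) = \<rho> powi k * measure M ?D"
    proof (cases "E = {}")
      case False
      then consider "k = 1" "?D \<subseteq> S" | "k = - 1" "?D \<inter> S = {}"
        using E(2) unfolding c_def by (cases "k = 1") (auto split: if_splits)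
      then show ?thesis
      proof cases
        case 1
        then show ?thesis using scale[OF D(1)] by simp
      next
        case 2
        then have "?D \<subseteq> \<Phi> ` (S - NP)" using D_off N by blast
        then have "measure M ?D = \<rho> * measure M (\<Phi> ` (?D - NP))"
          using involution_scales_back[OF P invol scale sets.sets_into_space[OF S] D(1)] by simp
        then show ?thesis using pos 2 by (simp add: power_int_minus field_simps)
      qed
    qed simp
    then show "emeasure M (F ` E) = ennreal (\<rho> powi k) * emeasure M E"
      unfolding D(2)[symmetric] FE using pos by (simp add: emeasure_eq_measure ennreal_mult')
  qed
  moreover have "maharam_extension F T S = (\<lambda>(x, n). (F x, n + c x))"
    by (auto simp: maharam_extension_def c_def fun_eq_iff)
  ultimately show ?thesis by simp
qed

end
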